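(* Let $P$ be a program (built from assignments, if-then-else and sequential composition, as described in the context) whose variables are $x_1,\ldots,x_n$, and let $[P]$ be its translation into FOOL with tuples, defined with respect to the tuple $(x_1,\ldots,x_n)$. Let $u_1,\ldots,u_n,v_1,\ldots,v_n$ be values, where $u_i$ and $v_i$ are of the same type as $x_i$ for each $i$. If executing $P$ changes the state $\{x_1\to u_1,\ldots,x_n\to u_n\}$ to the state $\{x_1\to v_1,\ldots,x_n\to v_n\}$, then the value of the expression $[P]$ in the state $\{x_1\to u_1,\ldots,x_n\to u_n\}$ is the tuple $(v_1,\ldots,v_n)$.
   Context: Programs. Fix typed program variables $x_1,\ldots,x_n$ and a first-order signature with a fixed interpretation (e.g. integer arithmetic). A program is generated by the grammar: an assignment $x_i := e$, where $e$ is a term over the signature whose free variables are among $x_1,\ldots,x_n$ and whose type is that of $x_i$; a conditional $\textbf{if } e \textbf{ then } P_1 \textbf{ else } P_2$, where $e$ is a boolean term (formula) over $x_1,\ldots,x_n$ and $P_1,P_2$ are programs; and a sequential composition $P_1 ; P_2$. A state is an assignment of values to $x_1,\ldots,x_n$; programs have the standard deterministic semantics (an assignment updates the one variable to the value of $e$ in the current state; a conditional executes $P_1$ if $e$ is true in the current state and $P_2$ otherwise; $P_1;P_2$ executes $P_1$ then $P_2$). FOOL with tuples. FOOL is many-sorted first-order logic in which there is a boolean sort whose terms are identified with formulas, together with expressions $\mathtt{if}\ \varphi\ \mathtt{then}\ s\ \mathtt{else}\ t$ (value of $s$ if $\varphi$ is true, of $t$ otherwise) and $\mathtt{let}\ \ldots\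 \mathtt{in}\ \ldots$ expressions. It is extended with tuple expressions: if $t_i$ has type $\sigma_i$ then $(t_1,\ldots,t_n)$ has type $(\sigma_1,\ldots,\sigma_n)$, and with tuple bindings $\mathtt{let}\ (x_1,\ldots,x_n) = E\ \mathtt{in}\ F$, whose value in a state $s$ is the value of $F$ in the state obtained from $s$ by setting $x_i$ to $w_i$ for each $i$, where $(w_1,\ldots,w_n)$ is the value of $E$ in $s$. The value of a tuple expression $(t_1,\ldots,t_n)$ is the tuple of values of its components. Translation. $[P]$ always has the form $\mathtt{let}\ D\ \mathtt{in}\ (x_1,\ldots,x_n)$ and is defined inductively: - $[x_i := e]$ is $\mathtt{let}\ (x_1,\ldots,x_n) = (x_1,\ldots,x_{i-1},e,x_{i+1},\ldots,x_n)\ \mathtt{in}\ (x_1,\ldots,x_n)$; - $[\textbf{if } e \textbf{ then } P_1 \textbf{ else } P_2]$ is $\mathtt{let}\ (x_1,\ldots,x_n) = (\mathtt{if}\ e\ \mathtt{then}\ [P_1]\ \mathtt{else}\ [P_2])\ \mathtt{in}\ (x_1,\ldots,x_n)$; - $[P_1;P_2]$ is $\mathtt{let}\ D\ \mathtt{in}\ [P_2]$, where $[P_1]$ is $\mathtt{let}\ D\ \mathtt{in}\ (x_1,\ldots,x_n)$. *)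

theory Defs
  imports Main
begin

section \<open>Types, values and signatures\<close>

datatype 's ty = BoolT | SortT 's | TupT "'s ty list"

datatype 'v val = VBool bool | VElem 'v | VTup "'v val list"

text \<open>Predicate symbols are function symbols with result type \<^term>\<open>BoolT\<close>.\<close>

type_synonym ('f, 's) signature = "'f \<rightharpoonup> 's ty list \<times> 's ty"
type_synonym ('f, 'v) interp = "'f \<Rightarrow> 'v val list \<Rightarrow> 'v val"
type_synonym ('x, 's) ctxt = "'x \<rightharpoonup> 's ty"
type_synonym ('x, 'v) state = "'x \<rightharpoonup> 'v val"

text \<open>\<open>C\<close> gives the carrier of each uninterpreted sort.\<close>

inductive of_type :: "('s \<Rightarrow> 'v set) \<Rightarrow> 'v val \<Rightarrow> 's ty \<Rightarrow> bool" for C where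
  "of_type C (VBool b) BoolT"
| "a \<in> C \<sigma> \<Longrightarrow> of_type C (VElem a) (SortT \<sigma>)"
| "list_all2 (of_type C) vs ts \<Longrightarrow> of_type C (VTup vs) (TupT ts)"

definition wf_interp :: "('f, 's) signature \<Rightarrow> ('s \<Rightarrow> 'v set) \<Rightarrow> ('f, 'v) interp \<Rightarrow> bool" where
  "wf_interp Sig C I \<longleftrightarrow>
     (\<forall>\<sigma>. C \<sigma> \<noteq> {}) \<and>
     (\<forall>f ts t vs. Sig f = Some (ts, t) \<longrightarrow> list_all2 (of_type C) vs ts \<longrightarrow> of_type C (I f vs) t)"

section \<open>FOOL with tuples\<close>

text \<open>
  There is no separate syntactic category of formulas: they are the expressions of type
  \<^term>\<open>BoolT\<close>. The expression \<open>LetFun f [(y\<^sub>1, t\<^sub>1), \<dots>] E F\<close> is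
  \<open>let f(y\<^sub>1 : t\<^sub>1, \<dots>) = E in F\<close>, and \<open>LetTup [y\<^sub>1, \<dots>] E F\<close> is
  \<open>let (y\<^sub>1, \<dots>) = E in F\<close>; neither is recursive.
\<close>

datatype ('f, 's, 'x) fool =
    Var 'x
  | Fun 'f "('f, 's, 'x) fool list"
  | BConst bool
  | Neg "('f, 's, 'x) fool"
  | And "('f, 's, 'x) fool" "('f, 's, 'x) fool"
  | Or "('f, 's, 'x) fool" "('f, 's, 'x) fool"
  | Imp "('f, 's, 'x) fool" "('f, 's, 'x) fool"
  | Eq "('f, 's, 'x) fool" "('f, 's, 'x) fool"
  | Forall 'x "'s ty" "('f, 's, 'x) fool"
  | Exists 'x "'s ty" "('f, 's, 'x) fool"
  | Ite "('f, 's, 'x) fool" "('f, 's, 'x) fool" "('f, 's, 'x) fool"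
  | Tuple "('f, 's, 'x) fool list"
  | LetFun 'f "('x \<times> 's ty) list" "('f, 's, 'x) fool" "('f, 's, 'x) fool"
  | LetTup "'x list" "('f, 's, 'x) fool" "('f, 's, 'x) fool"

text \<open>
  A well-typed expression has all its free variables in the domain of the typing context.
\<close>

inductive wt :: "('f, 's) signature \<Rightarrow> ('x, 's) ctxt \<Rightarrow> ('f, 's, 'x) fool \<Rightarrow> 's ty \<Rightarrow> bool" where
  "G x = Some t \<Longrightarrow> wt Sig G (Var x) t"
| "Sig f = Some (ts, t) \<Longrightarrow> list_all2 (wt Sig G) es ts \<Longrightarrow> wt Sig G (Fun f es) t"
| "wt Sig G (BConst b) BoolT"
| "wt Sig G e BoolT \<Longrightarrow> wt Sig G (Neg e) BoolT"
| "wt Sig G e1 BoolT \<Longrightarrow> wt Sig G e2 BoolT \<Longrightarrow> wt Sig G (And e1 e2) BoolT"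
| "wt Sig G e1 BoolT \<Longrightarrow> wt Sig G e2 BoolT \<Longrightarrow> wt Sig G (Or e1 e2) BoolT"
| "wt Sig G e1 BoolT \<Longrightarrow> wt Sig G e2 BoolT \<Longrightarrow> wt Sig G (Imp e1 e2) BoolT"
| "wt Sig G e1 t \<Longrightarrow> wt Sig G e2 t \<Longrightarrow> wt Sig G (Eq e1 e2) BoolT"
| "wt Sig (G(x \<mapsto> t)) e BoolT \<Longrightarrow> wt Sig G (Forall x t e) BoolT"
| "wt Sig (G(x \<mapsto> t)) e BoolT \<Longrightarrow> wt Sig G (Exists x t e) BoolT"
| "wt Sig G c BoolT \<Longrightarrow> wt Sig G e1 t \<Longrightarrow> wt Sig G e2 t \<Longrightarrow> wt Sig G (Ite c e1 e2) t"
| "list_all2 (wt Sig G) es ts \<Longrightarrow> wt Sig G (Tuple es) (TupT ts)"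
| "distinct (map fst yts) \<Longrightarrow> wt Sig (G(map fst yts [\<mapsto>] map snd yts)) E r \<Longrightarrow>
     wt (Sig(f \<mapsto> (map snd yts, r))) G F t \<Longrightarrow> wt Sig G (LetFun f yts E F) t"
| "distinct ys \<Longrightarrow> length ys = length ts \<Longrightarrow> wt Sig G E (TupT ts) \<Longrightarrow>
     wt Sig (G(ys [\<mapsto>] ts)) F t \<Longrightarrow> wt Sig G (LetTup ys E F) t"

text \<open>The value is arbitrary on ill-typed expressions.\<close>

fun fool_value ::
  "('s \<Rightarrow> 'v set) \<Rightarrow> ('f, 'v) interp \<Rightarrow> ('x, 'v) state \<Rightarrow> ('f, 's, 'x) fool \<Rightarrow> 'v val" where
  "fool_value C I s (Var x) = the (s x)"
| "fool_value C I s (Fun f es) = I f (map (fool_value C I s) es)"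
| "fool_value C I s (BConst b) = VBool b"
| "fool_value C I s (Neg e) = VBool (fool_value C I s e \<noteq> VBool True)"
| "fool_value C I s (And e1 e2) =
     VBool (fool_value C I s e1 = VBool True \<and> fool_value C I s e2 = VBool True)"
| "fool_value C I s (Or e1 e2) =
     VBool (fool_value C I s e1 = VBool True \<or> fool_value C I s e2 = VBool True)"
| "fool_value C I s (Imp e1 e2) =
     VBool (fool_value C I s e1 = VBool True \<longrightarrow> fool_value C I s e2 = VBool True)"
| "fool_value C I s (Eq e1 e2) = VBool (fool_value C I s e1 = fool_value C I s e2)"
| "fool_value C I s (Forall x t e) =
     VBool (\<forall>w. of_type C w t \<longrightarrow> fool_value C I (s(x \<mapsto> w)) e = VBool True)"
| "fool_value C I s (Exists x t e) =
     VBool (\<exists>w. of_type C w t \<and> fool_value C I (s(x \<mapsto> w)) e = VBool True)"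
| "fool_value C I s (Ite c e1 e2) =
     (if fool_value C I s c = VBool True then fool_value C I s e1 else fool_value C I s e2)"
| "fool_value C I s (Tuple es) = VTup (map (fool_value C I s) es)"
| "fool_value C I s (LetFun f yts E F) =
     fool_value C (I(f := \<lambda>ws. fool_value C I (s(map fst yts [\<mapsto>] ws)) E)) s F"
| "fool_value C I s (LetTup ys E F) =
     (case fool_value C I s E of
        VTup ws \<Rightarrow> fool_value C I (s(ys [\<mapsto>] ws)) F
      | _ \<Rightarrow> undefined)"

section \<open>Programs\<close>

datatype ('f, 's, 'x) prog =
    Assign 'x "('f, 's, 'x) fool"
  | Cond "('f, 's, 'x) fool" "('f, 's, 'x) prog" "('f, 's, 'x) prog"
  | Seq "('f, 's, 'x) prog" "('f, 's, 'x) prog"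

text \<open>The domain of \<open>G\<close> is the set of program variables.\<close>

fun wf_prog :: "('f, 's) signature \<Rightarrow> ('x, 's) ctxt \<Rightarrow> ('f, 's, 'x) prog \<Rightarrow> bool" where
  "wf_prog Sig G (Assign x e) \<longleftrightarrow> (\<exists>t. G x = Some t \<and> wt Sig G e t)"
| "wf_prog Sig G (Cond e P1 P2) \<longleftrightarrow> wt Sig G e BoolT \<and> wf_prog Sig G P1 \<and> wf_prog Sig G P2"
| "wf_prog Sig G (Seq P1 P2) \<longleftrightarrow> wf_prog Sig G P1 \<and> wf_prog Sig G P2"

fun exec ::
  "('s \<Rightarrow> 'v set) \<Rightarrow> ('f, 'v) interp \<Rightarrow> ('f, 's, 'x) prog \<Rightarrow> ('x, 'v) state \<Rightarrow> ('x, 'v) state" where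
  "exec C I (Assign x e) s = s(x \<mapsto> fool_value C I s e)"
| "exec C I (Cond e P1 P2) s =
     (if fool_value C I s e = VBool True then exec C I P1 s else exec C I P2 s)"
| "exec C I (Seq P1 P2) s = exec C I P2 (exec C I P1 s)"

section \<open>Translation\<close>

text \<open>
  In the form \<open>let D in (x\<^sub>1, \<dots>, x\<^sub>n)\<close>, \<open>D\<close> stands for a sequence of tuple bindings, each
  in the scope of the previous ones: \<open>let D\<^sub>1 in let D\<^sub>2 in \<dots>\<close>. The function \<open>bindings\<close>
  recovers the sequence \<open>D\<close>, which is unique because the innermost body is not itself a
  \<open>let\<close> (lemmas \<open>bindings_let_in\<close> and \<open>translate_form\<close> below). For distinct \<open>xs\<close>,
  \<open>map (Var(x := e)) xs\<close> is \<open>x\<^sub>1, \<dots>, x\<^sub>n\<close> with the one occurrence of \<open>x\<close> replaced by \<open>e\<close>.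
\<close>

fun let_in :: "('x list \<times> ('f, 's, 'x) fool) list \<Rightarrow> ('f, 's, 'x) fool \<Rightarrow> ('f, 's, 'x) fool" where
  "let_in [] F = F"
| "let_in ((ys, E) # D) F = LetTup ys E (let_in D F)"

fun bindings :: "('f, 's, 'x) fool \<Rightarrow> ('x list \<times> ('f, 's, 'x) fool) list" where
  "bindings (LetTup ys E F) = (ys, E) # bindings F"
| "bindings _ = []"

fun translate :: "'x list \<Rightarrow> ('f, 's, 'x) prog \<Rightarrow> ('f, 's, 'x) fool" where
  "translate xs (Assign x e) = LetTup xs (Tuple (map (Var(x := e)) xs)) (Tuple (map Var xs))"
| "translate xs (Cond e P1 P2) = LetTup xs (Ite e (translate xs P1) (translate xs P2)) (Tuple (map Var xs))"
| "translate xs (Seq P1 P2) = let_in (bindings (translate xs P1)) (translate xs P2)"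

lemma bindings_let_in: "bindings (let_in D (Tuple es)) = D"
  by (induction D) auto

lemma let_in_append: "let_in (D1 @ D2) F = let_in D1 (let_in D2 F)"
  by (induction D1 F rule: let_in.induct) auto

lemma translate_form: "translate xs P = let_in (bindings (translate xs P)) (Tuple (map Var xs))"
proof (induction P)
  case (Seq P1 P2)
  then show ?case
    by (metis bindings_let_in let_in_append translate.simps(3))
qed auto

end

(* A strengthening that is stable under composition: for every expression F, the value of
   "let D in F", where D is the binding sequence of [P], is the value of F after executing P.
   The theorem is the instance where F is the tuple of program variables. *)
theory Submission
  imports Defs
begin

text \<open>Every occurrence of a variable in \<open>xs\<close> is bound to the same
  \<open>g x\<close>, so the order of the updates does not matter.\<close>

lemma map_upds_map_apply:
  "(m(xs [\<mapsto>] map g xs)) x = (if x \<in> set xs then Some (g x) else m x)"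
  by (induction xs arbitrary: m) auto

text \<open>Distinctness keeps a later binding from overwriting an earlier one. This reads the tuple
  of final values off the final state.\<close>

lemma map_the_map_upds:
  assumes "distinct xs" "length xs = length vs"
  shows "map (the \<circ> m(xs [\<mapsto>] vs)) xs = vs"
proof -
  have "map (the \<circ> m(xs [\<mapsto>] vs)) xs = map the (map (m(xs [\<mapsto>] vs)) xs)"
    by simp
  also have "map (m(xs [\<mapsto>] vs)) xs = map Some vs"
    using assms(2,1)
    by (induction xs vs arbitrary: m rule: list_induct2) (auto simp: map_upds_apply_nontin)
  finally show ?thesis
    by (simp add: comp_def)
qed

text \<open>Assignment targets lie in \<open>dom G\<close>, so no update enlarges the domain. Hence
  \<open>the\<close> stays meaningful on program variables in every intermediate state.\<close>

lemma dom_exec: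
  "wf_prog Sig G P \<Longrightarrow> dom G \<subseteq> dom s \<Longrightarrow> dom (exec C I P s) = dom s"
  by (induction P arbitrary: s) auto

lemma exec_outside:
  "wf_prog Sig G P \<Longrightarrow> x \<notin> dom G \<Longrightarrow> exec C I P s x = s x"
  by (induction P arbitrary: s) auto

text \<open>This lets a single tuple binding simulate a program: rebinding \<open>xs\<close> to the
  final values restores the whole final state, because execution leaves everything outside
  \<open>xs\<close> alone.\<close>

lemma map_upds_exec:
  assumes "wf_prog Sig G P" "dom G = set xs" "set xs \<subseteq> dom s"
  shows "s(xs [\<mapsto>] map (the \<circ> exec C I P s) xs) = exec C I P s"
proof
  fix x
  show "(s(xs [\<mapsto>] map (the \<circ> exec C I P s) xs)) x = exec C I P s x"
  proof (cases "x \<in> set xs")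
    case True
    then have "x \<in> dom (exec C I P s)"
      using assms dom_exec[of Sig G P s C I] by auto
    then show ?thesis
      using True by (auto simp: map_upds_map_apply)
  next
    case False
    then show ?thesis
      using assms exec_outside[of Sig G P x C I s] by (simp add: map_upds_map_apply)
  qed
qed

lemma fool_value_let_bindings:
  assumes "wf_prog Sig G P" "dom G = set xs" "set xs \<subseteq> dom s"
  shows "fool_value C I s (let_in (bindings (translate xs P)) F) = fool_value C I (exec C I P s) F"
  using assms
proof (induction P arbitrary: s F)
  case (Assign x e)
  \<comment> \<open>All components are evaluated in the old state \<open>s\<close>, as is the
    right-hand side of the assignment.\<close>
  have "map (fool_value C I s) (map (Var(x := e)) xs) = map (the \<circ> exec C I (Assign x e) s) xs"
    by auto
  then show ?case
    using map_upds_exec[OF Assign.prems, of C I] by (simp del: map_map exec.simps)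
next
  case (Cond e P1 P2)
  \<comment> \<open>The branches occur as complete expressions [P_i], so the induction hypothesis is
    needed with the tuple of variables as body.\<close>
  have branch: "fool_value C I s (translate xs P) = VTup (map (the \<circ> exec C I P s) xs)"
    if "\<And>F. fool_value C I s (let_in (bindings (translate xs P)) F)
          = fool_value C I (exec C I P s) F" for P
    using that[of "Tuple (map Var xs)"] by (simp flip: translate_form)
  have "fool_value C I s (translate xs P1) = VTup (map (the \<circ> exec C I P1 s) xs)"
    "fool_value C I s (translate xs P2) = VTup (map (the \<circ> exec C I P2 s) xs)"
    using Cond by (auto intro!: branch)
  then have "fool_value C I s (Ite e (translate xs P1) (translate xs P2))
      = VTup (map (the \<circ> exec C I (Cond e P1 P2) s) xs)"
    by simp
  then show ?case
    using map_upds_exec[OF Cond.prems, of C I] by (simp del: exec.simps fool_value.simps(11))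
next
  case (Seq P1 P2)
  have "set xs \<subseteq> dom (exec C I P1 s)"
    using Seq.prems dom_exec[of Sig G P1 s C I] by simp
  \<comment> \<open>Concatenation lets the hypothesis for \<open>P1\<close> take the remaining
    bindings around \<open>F\<close> as its body; the one for \<open>P2\<close> then applies in the
    state reached by \<open>P1\<close>.\<close>
  moreover have "bindings (translate xs (Seq P1 P2))
      = bindings (translate xs P1) @ bindings (translate xs P2)"
    by (metis bindings_let_in let_in_append translate.simps(3) translate_form)
  ultimately show ?case
    using Seq by (simp add: let_in_append del: translate.simps)
qed

theorem theorem1:
  fixes Sig :: "('f, 's) signature"
    and C :: "'s \<Rightarrow> 'v set"
    and I :: "('f, 'v) interp"
    and xs :: "'x list"
    and ts :: "'s ty list"
    and P :: "('f, 's, 'x) prog"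
    and us vs :: "'v val list"
  assumes "wf_interp Sig C I"
    and "distinct xs"
    and "length xs = length ts"
    and "wf_prog Sig [xs [\<mapsto>] ts] P"
    and "list_all2 (of_type C) us ts"
    and "list_all2 (of_type C) vs ts"
    and "exec C I P [xs [\<mapsto>] us] = [xs [\<mapsto>] vs]"
  shows "fool_value C I [xs [\<mapsto>] us] (translate xs P) = VTup vs"
proof -
  have len: "length xs = length us" "length xs = length vs"
    using assms(3,5,6) by (simp_all add: list_all2_lengthD)
  \<comment> \<open>A multiple update stops at the shorter list, so equal lengths ensure that every
    variable of \<open>xs\<close> is bound.\<close>
  have doms: "dom [xs [\<mapsto>] ts] = set xs" "set xs \<subseteq> dom [xs [\<mapsto>] us]"
    using assms(3) len by simp_all
  have "fool_value C I [xs [\<mapsto>] us] (translate xs P)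
      = fool_value C I (exec C I P [xs [\<mapsto>] us]) (Tuple (map Var xs))"
    using fool_value_let_bindings[OF assms(4) doms, where F = "Tuple (map Var xs)"]
    by (simp flip: translate_form)
  also have "\<dots> = VTup (map (the \<circ> [xs [\<mapsto>] vs]) xs)"
    using assms(7) by simp
  also have "\<dots> = VTup vs"
    using map_the_map_upds[OF assms(2) len(2)] by simp
  finally show ?thesis .
qed

end
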